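(* Let $T$ be a random load vector in $\mathbb{R}^N_{\ge0}$, let $\mathcal{A}_E=\{a\in\mathbb{R}^N: a\ge0,\ \mathbf{1}^\top a=E\}$ be the simplex of feasible actions with budget $E$, and let the task loss be $\ell(t,a)=f(t,a)-f(t,\phi^*(t))$, where $f(t,a)=\|t+a\|^2$ and $\phi^*(t)$ is the minimizer of $f(t,\cdot)$ over $\mathcal{A}_E$. For any measurable $K$-cell partition $\{\mathcal{C}_k\}$ of load space with $\Pr(T\in\mathcal{C}_k)>0$, define $\mu_k=\mathbb{E}[T\mid T\in\mathcal{C}_k]$. The task-optimal action in cell $k$ (the minimizer over $a\in\mathcal{A}_E$ of $\mathbb{E}[\ell(T,a)\mid T\in\mathcal{C}_k]$) is $$a_k^*=\operatorname{WF}_E(\mu_k)=(\lambda_k\mathbf{1}-\mu_k)^+ .$$ Conversely, for fixed feasible actions $a_1,\dots,a_K\in\mathcal{A}_E$, the optimal encoder (the one minimizing expected task loss) assigns $t$ to any index $k$ that minimizes $$2t^\top a_k+\|a_k\|^2 .$$ Consequently, each pairwise cell boundary is a hyperplane and the cells form an affine power diagram in load space.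
   Context: $\|\cdot\|$ is the Euclidean norm, $\mathbf{1}$ is the all-ones vector, vector inequalities are coordinatewise, and $x^+$ is the coordinatewise positive part. Load $t=(t_1,\dots,t_N)$ is a vector of baseline loads over $N$ time slots; load space is the space of such $t$; an action $a$ allocates a controllable demand of total $E$ over the slots. Water-filling: $\operatorname{WF}_E(x)=(\lambda\mathbf{1}-x)^+$, where $\lambda=\lambda(x)$ makes the coordinates sum to $E$; $\lambda_k$ denotes $\lambda(\mu_k)$, and $\phi^*(t)=\operatorname{WF}_E(t)$. An encoder maps each load $t$ to an index in $\{1,\dots,K\}$, with cell $k$ the set of loads assigned index $k$; the action $a_k$ is then applied. The pairwise boundary between cells $j$ and $k$ is where $2t^\top a_j+\|a_j\|^2=2t^\top a_k+\|a_k\|^2$. A power diagram is a partition into cells on each of which one of finitely many functions $\|t-s_k\|^2-w_k$ (sites $s_k$, weights $w_k$) is minimal; equivalently, one of finitely many affine functions of $t$ is minimal. *)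

theory Defs
  imports "HOL-Probability.Probability"
begin

definition feasible :: "real \<Rightarrow> (real ^ 'n) set" where
  "feasible E = {a. 0 \<le> a \<and> (\<Sum>i\<in>UNIV. a $ i) = E}"

definition cost :: "real ^ 'n \<Rightarrow> real ^ 'n \<Rightarrow> real" where
  "cost t a = (norm (t + a))\<^sup>2"

definition best_action :: "real \<Rightarrow> real ^ 'n \<Rightarrow> real ^ 'n" where
  "best_action E t = arg_min_on (cost t) (feasible E)"

definition task_loss :: "real \<Rightarrow> real ^ 'n \<Rightarrow> real ^ 'n \<Rightarrow> real" where
  "task_loss E t a = cost t a - cost t (best_action E t)"

text \<open>The level is unique for \<open>E > 0\<close>. For \<open>E = 0\<close> it is not, but then every admissible
  choice gives the same water-filling vector, namely zero.\<close>

definition water_level :: "real \<Rightarrow> real ^ 'n \<Rightarrow> real" where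
  "water_level E x = (SOME l. (\<Sum>i\<in>UNIV. max 0 (l - x $ i)) = E)"

definition WF :: "real \<Rightarrow> real ^ 'n \<Rightarrow> real ^ 'n" where
  "WF E x = (\<chi> i. max 0 (water_level E x - x $ i))"

text \<open>Elementary conditional expectation given an event of positive probability.\<close>

definition expectation_given ::
    "'a measure \<Rightarrow> 'a set \<Rightarrow> ('a \<Rightarrow> 'b::{banach, second_countable_topology}) \<Rightarrow> 'b" where
  "expectation_given M A X = integral\<^sup>L (uniform_measure M A) X"

definition cell_partition :: "nat \<Rightarrow> 'b set \<Rightarrow> (nat \<Rightarrow> 'b set) \<Rightarrow> bool" where
  "cell_partition K L C \<longleftrightarrow> disjoint_family_on C {1..K} \<and> (\<Union>k\<in>{1..K}. C k) = L"

definition encoders :: "nat \<Rightarrow> (real ^ 'n) set \<Rightarrow> (real ^ 'n \<Rightarrow> nat) set" where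
  "encoders K L = measurable (restrict_space borel L) (count_space {1..K})"

definition expected_loss ::
    "'a measure \<Rightarrow> ('a \<Rightarrow> real ^ 'n) \<Rightarrow> real \<Rightarrow> (nat \<Rightarrow> real ^ 'n) \<Rightarrow> (real ^ 'n \<Rightarrow> nat) \<Rightarrow> real" where
  "expected_loss M T E a e = (\<integral>\<omega>. task_loss E (T \<omega>) (a (e (T \<omega>))) \<partial>M)"

definition score :: "(nat \<Rightarrow> real ^ 'n) \<Rightarrow> real ^ 'n \<Rightarrow> nat \<Rightarrow> real" where
  "score a t k = 2 * (t \<bullet> a k) + (norm (a k))\<^sup>2"

definition pairwise_boundary :: "(nat \<Rightarrow> real ^ 'n) \<Rightarrow> nat \<Rightarrow> nat \<Rightarrow> (real ^ 'n) set" where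
  "pairwise_boundary a j k = {t. score a t j = score a t k}"

definition is_hyperplane :: "(real ^ 'n) set \<Rightarrow> bool" where
  "is_hyperplane H \<longleftrightarrow> (\<exists>v c. v \<noteq> 0 \<and> H = {t. v \<bullet> t = c})"

text \<open>Sites and weights are parameters: if they were quantified existentially, equal sites with
  equal weights would turn every partition into a power diagram. Points at which several of the
  functions are minimal may lie in any of the corresponding cells.\<close>

definition power_diagram ::
    "nat \<Rightarrow> (real ^ 'n) set \<Rightarrow> (nat \<Rightarrow> real ^ 'n) \<Rightarrow> (nat \<Rightarrow> real) \<Rightarrow> (nat \<Rightarrow> (real ^ 'n) set) \<Rightarrow> bool"
  where
  "power_diagram K L s w C \<longleftrightarrow> cell_partition K L C \<and>
     (\<forall>k\<in>{1..K}. \<forall>t\<in>C k.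
        is_arg_min (\<lambda>j. (norm (t - s j))\<^sup>2 - w j) (\<lambda>j. j \<in> {1..K}) k)"

end

theory Submission
  imports Defs
begin

text \<open>Since \<open>cost t a = (norm t)\<^sup>2 + (2 * (t \<bullet> a) + (norm a)\<^sup>2)\<close>, the quadratic part in \<open>t\<close> cancels
  from the task loss, which is therefore affine in \<open>t\<close> up to a term not depending on \<open>a\<close>. Averaging
  over a cell thus replaces \<open>t\<close> by the cell mean, and the optimal action at any load is the
  water-filling vector \<open>w\<close> because \<open>(x + w) \<bullet> (a - w) \<ge> 0\<close> for every feasible \<open>a\<close>. For fixed actions,
  an encoder that minimizes the score pointwise exists and is measurable, so the excess loss of any
  other encoder is the integral of a nonnegative function.\<close>

section \<open>Water-filling and its optimality\<close>

lemma water_level_exists: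
  fixes x :: "real ^ 'n"
  assumes "0 \<le> E"
  shows "\<exists>l. (\<Sum>i\<in>UNIV. max 0 (l - x $ i)) = E"
proof -
  let ?f = "\<lambda>l. \<Sum>i\<in>UNIV. max 0 (l - x $ i)"
  \<comment> \<open>Endpoints for the intermediate value theorem: at the smallest load
    \<open>m\<close> nothing is poured, and at height \<open>E\<close> above an arbitrary slot
    \<open>i0\<close> that slot alone already receives \<open>E\<close>.\<close>
  obtain i0 :: 'n where True by simp
  define m where "m = Min (range (($) x))"
  have m: "m \<le> x $ i" for i
    unfolding m_def by simp
  have "?f m = 0"
    using m by (intro sum.neutral) (auto simp: max_def intro: antisym)
  moreover have "E \<le> ?f (x $ i0 + E)"
  proof -
    have "E \<le> max 0 (x $ i0 + E - x $ i0)" by simp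
    also have "\<dots> \<le> ?f (x $ i0 + E)"
      by (rule member_le_sum) auto
    finally show ?thesis .
  qed
  moreover have "continuous_on {m..x $ i0 + E} ?f"
    by (intro continuous_intros)
  moreover have "m \<le> x $ i0 + E"
    using m[of i0] assms by simp
  ultimately show ?thesis
    using IVT'[of ?f m E "x $ i0 + E"] assms by auto
qed

lemma sum_water_level:
  fixes x :: "real ^ 'n"
  assumes "0 \<le> E"
  shows "(\<Sum>i\<in>UNIV. max 0 (water_level E x - x $ i)) = E"
  unfolding water_level_def by (rule someI_ex[OF water_level_exists[OF assms]])

lemma WF_feasible:
  fixes x :: "real ^ 'n"
  assumes "0 \<le> E"
  shows "WF E x \<in> feasible E"
  using sum_water_level[OF assms, of x]
  by (simp add: feasible_def WF_def less_eq_vec_def)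

text \<open>First-order optimality: \<open>x + WF E x\<close> is half the gradient of the cost. It
  equals the level \<open>l\<close> on every filled slot; elsewhere it exceeds \<open>l\<close>, but
  there \<open>a - WF E x\<close> reduces to \<open>a\<close>, which is nonnegative. Replacing it by
  the constant \<open>l\<close> therefore only lowers the inner product, and the constant
  contributes zero because both allocations have total \<open>E\<close>.\<close>

lemma WF_inner_nonneg:
  fixes x a :: "real ^ 'n"
  assumes E: "0 \<le> E" and a: "a \<in> feasible E"
  shows "0 \<le> (x + WF E x) \<bullet> (a - WF E x)"
proof -
  define l where "l = water_level E x"
  have sum_eq: "(\<Sum>i\<in>UNIV. a $ i) = (\<Sum>i\<in>UNIV. WF E x $ i)"
    using a WF_feasible[OF E, of x] by (simp add: feasible_def)
  have "l * (a $ i - WF E x $ i) \<le> (x $ i + WF E x $ i) * (a $ i - WF E x $ i)" for i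
  proof (cases "x $ i \<le> l")
    case True
    then show ?thesis by (simp add: WF_def l_def)
  next
    case False
    moreover have "0 \<le> a $ i"
      using a by (simp add: feasible_def less_eq_vec_def)
    ultimately show ?thesis
      by (simp add: WF_def l_def mult_right_mono)
  qed
  then have "(\<Sum>i\<in>UNIV. l * (a $ i - WF E x $ i)) \<le> (x + WF E x) \<bullet> (a - WF E x)"
    unfolding inner_vec_def by (intro sum_mono) simp
  also have "(\<Sum>i\<in>UNIV. l * (a $ i - WF E x $ i)) = 0"
    by (simp flip: sum_distrib_left add: sum_subtractf sum_eq)
  finally show ?thesis .
qed

lemma cost_expand:
  "cost t a = (norm t)\<^sup>2 + (2 * (t \<bullet> a) + (norm a)\<^sup>2)"
  by (simp add: cost_def power2_norm_eq_inner inner_simps inner_commute)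

text \<open>Expanding the square around \<open>WF E x\<close> leaves the first-order term, which is
  nonnegative. Keeping the squared distance in the bound is what later yields uniqueness of the
  minimizer.\<close>

lemma cost_WF_le:
  fixes x a :: "real ^ 'n"
  assumes "0 \<le> E" and "a \<in> feasible E"
  shows "cost x (WF E x) + (norm (a - WF E x))\<^sup>2 \<le> cost x a"
proof -
  have "cost x a = cost x (WF E x) + (norm (a - WF E x))\<^sup>2 + 2 * ((x + WF E x) \<bullet> (a - WF E x))"
    by (simp add: cost_def power2_norm_eq_inner inner_simps inner_commute)
  then show ?thesis
    using WF_inner_nonneg[OF assms, of x] by simp
qed

lemma is_arg_min_cost_iff:
  fixes x a :: "real ^ 'n"
  assumes E: "0 \<le> E"
  shows "is_arg_min (cost x) (\<lambda>a. a \<in> feasible E) a \<longleftrightarrow> a = WF E x"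
proof
  assume "is_arg_min (cost x) (\<lambda>a. a \<in> feasible E) a"
  then have a: "a \<in> feasible E" and "cost x a \<le> cost x (WF E x)"
    using WF_feasible[OF E, of x] by (auto simp: is_arg_min_linorder)
  with cost_WF_le[OF E a, of x] have "(norm (a - WF E x))\<^sup>2 \<le> 0"
    by linarith
  then show "a = WF E x" by simp
next
  assume a: "a = WF E x"
  have "cost x a \<le> cost x b" if "b \<in> feasible E" for b
    using cost_WF_le[OF E that, of x] zero_le_power2[of "norm (b - WF E x)"]
    unfolding a by linarith
  then show "is_arg_min (cost x) (\<lambda>a. a \<in> feasible E) a"
    using WF_feasible[OF E, of x] a by (auto simp: is_arg_min_linorder)
qed

section \<open>The task loss and its integrability\<close>

lemma best_action_eq_WF:
  fixes t :: "real ^ 'n"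
  assumes "0 \<le> E"
  shows "best_action E t = WF E t"
  \<comment> \<open>\<open>best_action\<close> is a Hilbert choice among minimizers, so this
    identification rests on uniqueness.\<close>
  by (simp add: best_action_def arg_min_on_def arg_min_def is_arg_min_cost_iff[OF assms])

text \<open>The optimal cost at load \<open>t\<close> with \<open>(norm t)\<^sup>2\<close> removed.
  Without that term the value grows only linearly in \<open>t\<close>, so a first moment of the load
  suffices for integrability.\<close>

definition optimal_value :: "real \<Rightarrow> real ^ 'n \<Rightarrow> real" where
  "optimal_value E t = 2 * (t \<bullet> WF E t) + (norm (WF E t))\<^sup>2"

lemma task_loss_eq:
  fixes t a :: "real ^ 'n"
  assumes "0 \<le> E"
  shows "task_loss E t a = 2 * (t \<bullet> a) + (norm a)\<^sup>2 - optimal_value E t"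
  by (simp add: task_loss_def best_action_eq_WF[OF assms] cost_expand optimal_value_def)

lemma norm_feasible_le:
  assumes "a \<in> feasible E"
  shows "norm a \<le> E"
proof -
  have "norm a \<le> (\<Sum>i\<in>UNIV. \<bar>a $ i\<bar>)" by (rule norm_le_l1_cart)
  also have "\<dots> = E" using assms by (simp add: feasible_def less_eq_vec_def)
  finally show ?thesis .
qed

text \<open>The optimal action for \<open>s\<close> serves as a trial action for \<open>t\<close>.
  With the action held fixed, the objective is affine in the load, with slope
  \<open>2 * WF E s\<close> of norm at most \<open>2 * E\<close>.\<close>

lemma optimal_value_diff_le:
  fixes s t :: "real ^ 'n"
  assumes E: "0 \<le> E"
  shows "optimal_value E t - optimal_value E s \<le> 2 * E * norm (t - s)"
proof -
  have "cost t (WF E t) \<le> cost t (WF E s)"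
    using is_arg_min_cost_iff[OF E, of t "WF E t"] WF_feasible[OF E, of s]
    by (auto simp: is_arg_min_linorder)
  then have "optimal_value E t - optimal_value E s \<le> 2 * ((t - s) \<bullet> WF E s)"
    by (simp add: cost_expand optimal_value_def inner_simps)
  also have "\<dots> \<le> 2 * (norm (t - s) * norm (WF E s))"
    using norm_cauchy_schwarz[of "t - s" "WF E s"] by simp
  also have "\<dots> \<le> 2 * (norm (t - s) * E)"
    using norm_feasible_le[OF WF_feasible[OF E, of s]] by (simp add: mult_left_mono)
  finally show ?thesis by (simp add: mult_ac)
qed

lemma optimal_value_lipschitz:
  fixes s t :: "real ^ 'n"
  assumes "0 \<le> E"
  shows "\<bar>optimal_value E t - optimal_value E s\<bar> \<le> 2 * E * norm (t - s)"
  using optimal_value_diff_le[OF assms, of t s] optimal_value_diff_le[OF assms, of s t]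
  by (simp add: norm_minus_commute abs_le_iff)

text \<open>Continuity of the value gives measurability without examining how the chosen
  \<open>water_level\<close> varies with the load.\<close>

lemma borel_measurable_optimal_value:
  assumes "0 \<le> E"
  shows "(optimal_value E :: real ^ 'n \<Rightarrow> real) \<in> borel_measurable borel"
proof -
  have "(2 * E)-lipschitz_on UNIV (optimal_value E :: real ^ 'n \<Rightarrow> real)"
    using optimal_value_lipschitz[OF assms] assms
    by (intro lipschitz_onI) (auto simp: dist_norm)
  then show ?thesis
    by (intro borel_measurable_continuous_onI lipschitz_on_continuous_on)
qed

lemma (in finite_measure) integrable_optimal_value:
  fixes T :: "'a \<Rightarrow> real ^ 'n"
  assumes E: "0 \<le> E" and T: "integrable M T"
  shows "integrable M (\<lambda>\<omega>. optimal_value E (T \<omega>))"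
proof (rule Bochner_Integration.integrable_bound)
  \<comment> \<open>The Lipschitz bound from the zero load gives an integrable affine majorant in
    \<open>norm (T \<omega>)\<close>.\<close>
  let ?v = "optimal_value E (0 :: real ^ 'n)"
  show "integrable M (\<lambda>\<omega>. 2 * E * norm (T \<omega>) + \<bar>?v\<bar>)"
    using T by simp
  show "(\<lambda>\<omega>. optimal_value E (T \<omega>)) \<in> borel_measurable M"
    by (rule measurable_compose[OF borel_measurable_integrable[OF T]
          borel_measurable_optimal_value[OF E]])
  have "norm (optimal_value E t) \<le> norm (2 * E * norm t + \<bar>?v\<bar>)" for t :: "real ^ 'n"
    using optimal_value_lipschitz[OF E, of t 0] E by simp
  then show "AE \<omega> in M. norm (optimal_value E (T \<omega>)) \<le> norm (2 * E * norm (T \<omega>) + \<bar>?v\<bar>)"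
    by simp
qed

section \<open>The optimal action in a cell\<close>

lemma (in prob_space) is_arg_min_expected_task_loss:
  fixes T :: "'a \<Rightarrow> real ^ 'n"
  assumes E: "0 \<le> E" and T: "integrable M T"
  shows "is_arg_min (\<lambda>a. \<integral>\<omega>. task_loss E (T \<omega>) a \<partial>M) (\<lambda>a. a \<in> feasible E) a
    \<longleftrightarrow> a = WF E (integral\<^sup>L M T)"
proof -
  let ?\<mu> = "integral\<^sup>L M T"
  define c where "c = (norm ?\<mu>)\<^sup>2 + (\<integral>\<omega>. optimal_value E (T \<omega>) \<partial>M)"
  \<comment> \<open>The action-dependent part is affine in the load, so averaging evaluates it at
    the mean. The constant \<open>c\<close> removes the squared norm of the mean contained in
    \<open>cost\<close> and subtracts the average optimal value; it does not depend on
    \<open>b\<close>.\<close>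
  have "(\<integral>\<omega>. task_loss E (T \<omega>) b \<partial>M) = cost ?\<mu> b - c" for b
    using T integrable_optimal_value[OF E T]
    by (simp add: task_loss_eq[OF E] cost_expand c_def prob_space)
  then show ?thesis
    using is_arg_min_cost_iff[OF E, of ?\<mu> a] by (simp add: is_arg_min_def)
qed

text \<open>Conditioning on \<open>A\<close> is a density with respect to \<open>M\<close> that is
  bounded by \<open>1 / measure M A\<close>, so it preserves integrability.\<close>

lemma integrable_uniform_measure:
  fixes f :: "'a \<Rightarrow> 'b::{banach, second_countable_topology}"
  assumes "finite_measure M" and A: "A \<in> sets M" "measure M A > 0" and f: "integrable M f"
  shows "integrable (uniform_measure M A) f"
proof -
  interpret finite_measure M by fact
  have "uniform_measure M A = density M (\<lambda>x. ennreal (indicator A x / measure M A))"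
    using A by (intro measure_eqI)
      (auto simp: uniform_measure_def emeasure_eq_measure divide_ennreal ennreal_indicator
         simp flip: divide_ennreal)
  moreover have "integrable M (\<lambda>x. (indicator A x / measure M A) *\<^sub>R f x)"
    using integrable_scaleR_right[of "1 / measure M A" M, OF integrable_mult_indicator[OF A(1) f]]
    by simp
  ultimately show ?thesis
    using A f by (simp add: integrable_density)
qed

section \<open>Optimal encoders for fixed actions\<close>

lemma measurable_encoder:
  assumes "e \<in> encoders K L" and "T \<in> borel_measurable M" and "\<And>\<omega>. \<omega> \<in> space M \<Longrightarrow> T \<omega> \<in> L"
  shows "(\<lambda>\<omega>. e (T \<omega>)) \<in> measurable M (count_space {1..K})"
  using assms unfolding encoders_def
  by (intro measurable_compose[of T M "restrict_space borel L" e] measurable_restrict_space2) auto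

lemma encoder_range:
  "e \<in> encoders K L \<Longrightarrow> t \<in> L \<Longrightarrow> e t \<in> {1..K}"
  using measurable_space[of e "restrict_space borel L" "count_space {1..K}" t]
  by (simp add: encoders_def space_restrict_space)

text \<open>An encoder takes finitely many values, so the selected score is a finite sum of affine
  functions of the load, each cut off by the indicator of a measurable event.\<close>

lemma (in finite_measure) integrable_score_encoder:
  fixes T :: "'a \<Rightarrow> real ^ 'n"
  assumes e: "e \<in> encoders K L" and T: "integrable M T"
    and TL: "\<And>\<omega>. \<omega> \<in> space M \<Longrightarrow> T \<omega> \<in> L"
  shows "integrable M (\<lambda>\<omega>. score a (T \<omega>) (e (T \<omega>)))"
proof -
  let ?B = "\<lambda>k. {\<omega> \<in> space M. e (T \<omega>) = k}"
  have eT: "(\<lambda>\<omega>. e (T \<omega>)) \<in> measurable M (count_space {1..K})"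
    by (rule measurable_encoder[OF e borel_measurable_integrable[OF T] TL])
  have B: "?B k \<in> sets M" if "k \<in> {1..K}" for k
    using measurable_sets[OF eT, of "{k}"] that by (simp add: vimage_def Int_def conj_commute)
  have "integrable M (\<lambda>\<omega>. \<Sum>k\<in>{1..K}. indicator (?B k) \<omega> *\<^sub>R score a (T \<omega>) k)"
    using T B unfolding score_def
    by (intro Bochner_Integration.integrable_sum integrable_mult_indicator) auto
  moreover have "(\<Sum>k\<in>{1..K}. indicator (?B k) \<omega> *\<^sub>R score a (T \<omega>) k) = score a (T \<omega>) (e (T \<omega>))"
    if "\<omega> \<in> space M" for \<omega>
    using encoder_range[OF e TL[OF that]] that
    by (simp add: indicator_def if_distrib[of "\<lambda>c. c * _"] cong: if_cong)
  ultimately show ?thesis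
    by (simp cong: Bochner_Integration.integrable_cong)
qed

lemma optimal_encoder_exists:
  fixes a :: "nat \<Rightarrow> real ^ 'n"
  assumes "1 \<le> K"
  shows "\<exists>e\<in>encoders K L. \<forall>t\<in>L. is_arg_min (score a t) (\<lambda>k. k \<in> {1..K}) (e t)"
proof -
  define P where "P k t \<longleftrightarrow> k \<in> {1..K} \<and> (\<forall>j\<in>{1..K}. score a t k \<le> score a t j)" for k t
  \<comment> \<open>Ties go to the smallest minimizing index; this explicit rule makes the selection
    measurable.\<close>
  define e where "e t = (LEAST k. P k t)" for t
  have ex: "\<exists>k. P k t" for t
    using ex_is_arg_min_if_finite[of "{1..K}" "score a t"] assms
    by (auto simp: P_def is_arg_min_linorder)
  have e: "P (e t) t" for t
    unfolding e_def using LeastI_ex[OF ex] .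
  have "Measurable.pred borel (P k)" for k
    unfolding P_def score_def by measurable
  then have "e \<in> measurable borel (count_space UNIV)"
    unfolding e_def by measurable
  then have "e \<in> measurable borel (count_space {1..K})"
    using e by (simp add: measurable_count_space_eq2 measurable_def P_def)
  then have "e \<in> encoders K L"
    unfolding encoders_def by (rule measurable_restrict_space1)
  moreover have "is_arg_min (score a t) (\<lambda>k. k \<in> {1..K}) (e t)" for t
    using e[of t] unfolding P_def is_arg_min_linorder by blast
  ultimately show ?thesis by blast
qed

text \<open>A pointwise minimizing encoder \<open>e0\<close> is the benchmark: \<open>e\<close> is
  optimal exactly when its excess over \<open>e0\<close> has integral zero, hence when the excess
  vanishes almost everywhere. Changes on null events do not affect the expected loss, which is why
  the criterion is an almost-everywhere one.\<close>

lemma (in prob_space) is_arg_min_expected_loss_iff: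
  fixes T :: "'a \<Rightarrow> real ^ 'n"
  assumes E: "0 \<le> E" and K: "1 \<le> K" and T: "integrable M T"
    and TL: "\<And>\<omega>. \<omega> \<in> space M \<Longrightarrow> T \<omega> \<in> L"
    and e: "e \<in> encoders K L"
  shows "is_arg_min (expected_loss M T E a) (\<lambda>e. e \<in> encoders K L) e \<longleftrightarrow>
    (AE \<omega> in M. is_arg_min (score a (T \<omega>)) (\<lambda>k. k \<in> {1..K}) (e (T \<omega>)))"
proof -
  let ?s = "\<lambda>e \<omega>. score a (T \<omega>) (e (T \<omega>))"
  obtain e0 where e0: "e0 \<in> encoders K L"
    and opt: "\<And>t. t \<in> L \<Longrightarrow> is_arg_min (score a t) (\<lambda>k. k \<in> {1..K}) (e0 t)"
    using optimal_encoder_exists[OF K] by blast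
  note int = integrable_score_encoder[OF _ T TL, where a = a]
  have loss: "expected_loss M T E a f = expected_loss M T E a e0 + (\<integral>\<omega>. ?s f \<omega> - ?s e0 \<omega> \<partial>M)"
    if f: "f \<in> encoders K L" for f
  proof -
    have "expected_loss M T E a g = (\<integral>\<omega>. ?s g \<omega> \<partial>M) - (\<integral>\<omega>. optimal_value E (T \<omega>) \<partial>M)"
      if g: "g \<in> encoders K L" for g
      unfolding expected_loss_def task_loss_eq[OF E]
      using Bochner_Integration.integral_diff[OF int[OF g] integrable_optimal_value[OF E T]]
      by (simp add: score_def)
    then show ?thesis
      using f e0 int[OF f] int[OF e0] by simp
  qed
  have le: "?s e0 \<omega> \<le> ?s f \<omega>" if "f \<in> encoders K L" "\<omega> \<in> space M" for f \<omega>
    using opt[OF TL[OF that(2)]] encoder_range[OF that(1) TL[OF that(2)]]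
    by (simp add: is_arg_min_linorder)
  have nonneg: "0 \<le> (\<integral>\<omega>. ?s f \<omega> - ?s e0 \<omega> \<partial>M)" if "f \<in> encoders K L" for f
    using le[OF that] by (intro Bochner_Integration.integral_nonneg_AE AE_I2) simp
  have "is_arg_min (expected_loss M T E a) (\<lambda>e. e \<in> encoders K L) e \<longleftrightarrow>
      (\<integral>\<omega>. ?s e \<omega> - ?s e0 \<omega> \<partial>M) = 0"
  proof
    assume "is_arg_min (expected_loss M T E a) (\<lambda>e. e \<in> encoders K L) e"
    then have "expected_loss M T E a e \<le> expected_loss M T E a e0"
      using e0 by (simp add: is_arg_min_linorder)
    then show "(\<integral>\<omega>. ?s e \<omega> - ?s e0 \<omega> \<partial>M) = 0"
      using loss[OF e] nonneg[OF e] by linarith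
  next
    assume "(\<integral>\<omega>. ?s e \<omega> - ?s e0 \<omega> \<partial>M) = 0"
    then have "expected_loss M T E a e \<le> expected_loss M T E a f" if "f \<in> encoders K L" for f
      using loss[OF e] loss[OF that] nonneg[OF that] by linarith
    with e show "is_arg_min (expected_loss M T E a) (\<lambda>e. e \<in> encoders K L) e"
      by (simp add: is_arg_min_linorder)
  qed
  also have "\<dots> \<longleftrightarrow> (AE \<omega> in M. ?s e \<omega> - ?s e0 \<omega> = 0)"
    using le[OF e] int[OF e] int[OF e0]
    by (intro integral_nonneg_eq_0_iff_AE AE_I2) auto
  also have "\<dots> \<longleftrightarrow> (AE \<omega> in M. is_arg_min (score a (T \<omega>)) (\<lambda>k. k \<in> {1..K}) (e (T \<omega>)))"
  \<comment> \<open>The index chosen by \<open>e0\<close> attains the minimal score, so an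
    admissible index with the same score is itself a minimizer.\<close>
  proof (rule AE_cong)
    fix \<omega> assume \<omega>: "\<omega> \<in> space M"
    have "e (T \<omega>) \<in> {1..K}" using encoder_range[OF e TL[OF \<omega>]] .
    then show "?s e \<omega> - ?s e0 \<omega> = 0 \<longleftrightarrow>
        is_arg_min (score a (T \<omega>)) (\<lambda>k. k \<in> {1..K}) (e (T \<omega>))"
      using opt[OF TL[OF \<omega>]] by (auto simp: is_arg_min_linorder intro: antisym)
  qed
  finally show ?thesis .
qed

section \<open>Geometry of the cells\<close>

lemma is_hyperplane_pairwise_boundary:
  fixes a :: "nat \<Rightarrow> real ^ 'n"
  assumes "a j \<noteq> a k"
  shows "is_hyperplane (pairwise_boundary a j k)"
  unfolding is_hyperplane_def
proof (intro exI conjI)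
  \<comment> \<open>The difference of two scores is affine in \<open>t\<close> with this normal
    vector; for equal actions the boundary would be the whole space.\<close>
  show "2 *\<^sub>R (a j - a k) \<noteq> 0" using assms by simp
  show "pairwise_boundary a j k = {t. (2 *\<^sub>R (a j - a k)) \<bullet> t = (norm (a k))\<^sup>2 - (norm (a j))\<^sup>2}"
    by (auto simp: pairwise_boundary_def score_def inner_simps inner_commute)
qed

text \<open>Completing the square: adding \<open>(norm t)\<^sup>2\<close>, which is the same for all
  indices, turns the score into the squared distance from \<open>t\<close> to the site
  \<open>- a k\<close>, with weight zero.\<close>

lemma power_diagram_arg_min_score:
  fixes a :: "nat \<Rightarrow> real ^ 'n"
  assumes "\<forall>t\<in>L. is_arg_min (score a t) (\<lambda>k. k \<in> {1..K}) (e t)"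
  shows "power_diagram K L (\<lambda>k. - a k) (\<lambda>k. 0) (\<lambda>k. {t \<in> L. e t = k})"
proof -
  have "(norm (t - - a k))\<^sup>2 - 0 = (norm t)\<^sup>2 + score a t k" for t k
    using cost_expand[of t "a k"] by (simp add: cost_def score_def)
  then show ?thesis
    using assms
    by (auto simp: power_diagram_def cell_partition_def disjoint_family_on_def is_arg_min_def)
qed

theorem proposition5:
  fixes M :: "'a measure" and T :: "'a \<Rightarrow> real ^ 'n" and E :: real and K :: nat
    and L :: "(real ^ 'n) set"
  assumes "prob_space M"
    and "T \<in> borel_measurable M"
    and "\<forall>\<omega>\<in>space M. 0 \<le> T \<omega>"
    and "integrable M T"
    and "0 \<le> E"
    and "1 \<le> K"
    and "L \<in> sets borel"
    and "{t. 0 \<le> t} \<subseteq> L"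
  shows
    "(\<forall>C. cell_partition K L C \<and> (\<forall>k\<in>{1..K}. C k \<in> sets borel) \<longrightarrow>
        (\<forall>k\<in>{1..K}. measure M {\<omega> \<in> space M. T \<omega> \<in> C k} > 0 \<longrightarrow>
          (let A = {\<omega> \<in> space M. T \<omega> \<in> C k};
               \<mu> = expectation_given M A T
           in \<forall>a. is_arg_min (\<lambda>a. expectation_given M A (\<lambda>\<omega>. task_loss E (T \<omega>) a))
                    (\<lambda>a. a \<in> feasible E) a \<longleftrightarrow> a = WF E \<mu>)))
     \<and>
     (\<forall>a. (\<forall>k\<in>{1..K}. a k \<in> feasible E) \<longrightarrow>
        (\<exists>e\<in>encoders K L. \<forall>t\<in>L. is_arg_min (score a t) (\<lambda>k. k \<in> {1..K}) (e t)) \<and>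
        (\<forall>e\<in>encoders K L.
           is_arg_min (expected_loss M T E a) (\<lambda>e. e \<in> encoders K L) e \<longleftrightarrow>
           (AE \<omega> in M. is_arg_min (score a (T \<omega>)) (\<lambda>k. k \<in> {1..K}) (e (T \<omega>)))) \<and>
        (\<forall>j\<in>{1..K}. \<forall>k\<in>{1..K}. a j \<noteq> a k \<longrightarrow> is_hyperplane (pairwise_boundary a j k)) \<and>
        (\<forall>e. (\<forall>t\<in>L. is_arg_min (score a t) (\<lambda>k. k \<in> {1..K}) (e t)) \<longrightarrow>
           power_diagram K L (\<lambda>k. - a k) (\<lambda>k. 0) (\<lambda>k. {t \<in> L. e t = k})))"
proof (intro conjI allI impI ballI)
  interpret prob_space M by fact
  \<comment> \<open>Loads are nonnegative, so they lie in the region on which encoders are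
    constrained.\<close>
  have TL: "T \<omega> \<in> L" if "\<omega> \<in> space M" for \<omega>
    using that assms(3,8) by auto
  {
    fix C k
    assume C: "cell_partition K L C \<and> (\<forall>k\<in>{1..K}. C k \<in> sets borel)" and k: "k \<in> {1..K}"
      and pos: "measure M {\<omega> \<in> space M. T \<omega> \<in> C k} > 0"
    define A where "A = {\<omega> \<in> space M. T \<omega> \<in> C k}"
    have A: "A \<in> sets M"
      using measurable_sets[OF assms(2), of "C k"] C k
      by (simp add: A_def vimage_def Int_def conj_commute)
    \<comment> \<open>The conditional law is again a probability space, so the result for an
      unconditioned load applies to it, with the cell mean as expectation.\<close>
    interpret cell: prob_space "uniform_measure M A"
      using pos A by (intro prob_space_uniform_measure) (simp_all add: A_def emeasure_eq_measure)
    have "integrable (uniform_measure M A) T"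
      using integrable_uniform_measure[OF _ A _ assms(4)] pos finite_measure_axioms
      by (simp add: A_def)
    from cell.is_arg_min_expected_task_loss[OF assms(5) this]
    show "let A = {\<omega> \<in> space M. T \<omega> \<in> C k}; \<mu> = expectation_given M A T
      in \<forall>a. is_arg_min (\<lambda>a. expectation_given M A (\<lambda>\<omega>. task_loss E (T \<omega>) a))
               (\<lambda>a. a \<in> feasible E) a \<longleftrightarrow> a = WF E \<mu>"
      by (simp add: Let_def expectation_given_def flip: A_def)
  next
    fix a :: "nat \<Rightarrow> real ^ 'n"
    show "\<exists>e\<in>encoders K L. \<forall>t\<in>L. is_arg_min (score a t) (\<lambda>k. k \<in> {1..K}) (e t)"
      by (rule optimal_encoder_exists[OF assms(6)])
  next
    fix a :: "nat \<Rightarrow> real ^ 'n" and e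
    assume "e \<in> encoders K L"
    from is_arg_min_expected_loss_iff[OF assms(5,6,4) TL this]
    show "is_arg_min (expected_loss M T E a) (\<lambda>e. e \<in> encoders K L) e \<longleftrightarrow>
      (AE \<omega> in M. is_arg_min (score a (T \<omega>)) (\<lambda>k. k \<in> {1..K}) (e (T \<omega>)))"
      by simp
  }
qed (blast intro: is_hyperplane_pairwise_boundary power_diagram_arg_min_score)+

end
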